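(* Let $R:[0,1]\times\mathbb{R}\to\mathbb{R}\cup\{\pm\infty\}$, $(r,m)\mapsto R(r,m)$, be a reward function that does not depend on individual performance: $R$ is increasing in each argument, real-valued for $r\in(0,1)$, and $\Pi(m):=\int_0^1R(r,m)\,dr<\infty$ for all $m\in\mathbb{R}$. Then the optimal centralized welfare is $$V_c=\sup_{m\in\mathbb{R}}\left\{\Pi(m)-\frac{c}{T}(m-x_0)^2\right\}.$$ Moreover, for each $m\in\mathbb{R}$, the minimum of $H(\mu\,|\,\mathcal{N}(x_0,\sigma^2T))$ over probability measures $\mu$ on $\mathbb{R}$ equivalent to Lebesgue measure with $\int_{\mathbb{R}}y\,d\mu(y)=m$ equals $\frac{(m-x_0)^2}{2\sigma^2T}$ and is attained by $\mathcal{N}(m,\sigma^2T)$.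
   Context: Fix constants $T,\sigma,c>0$ and $x_0\in\mathbb{R}$. "Increasing" is understood in the weak sense. Let $\Omega=C([0,T],\mathbb{R})$ with canonical process $X$, and let $P$ be the law on $\Omega$ of $(x_0+\sigma B_t)_{t\in[0,T]}$, $B$ a standard Brownian motion started at $0$. $H(\cdot|\cdot)$ denotes relative entropy, $H(Q|P)=E^Q[\ln(dQ/dP)]$. Write $Q_T$ for the law of $X_T$ under $Q$, and for a probability measure $\mu$ on $\mathbb{R}$ with finite mean and c.d.f. $F_\mu$ put $R_\mu(x)=R\left(F_\mu(x),\int_{\mathbb{R}}y\,d\mu(y)\right)$. The optimal centralized welfare (a social planner prescribes the same law for all players; the cost of effort $E^Q\int_0^Tca_t^2dt$ of the drift $a$ equals $2c\sigma^2H(Q|P)$) is $$V_c:=\sup_{Q}\left\{E^Q\left[R_{Q_T}(X_T)\right]-2c\sigma^2H(Q|P)\right\},$$ the supremum being over all probability measures $Q$ on $\Omega$ that are equivalent to $P$ and such that $Q_T$ has finite mean. *)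

theory Defs
  imports "HOL-Probability.Probability"
begin

text \<open>
  Integral of an extended-real function, \<open>\<integral>f\<^sup>+ - \<integral>f\<^sup>-\<close>. In \<open>ereal\<close> one has \<open>\<infinity> - \<infinity> = \<infinity>\<close>, so a value
  \<open>< \<infinity>\<close> entails that the positive part is integrable and hence that the integral is
  unambiguously defined in \<open>[-\<infinity>, \<infinity>)\<close>.
\<close>

definition ereal_integral :: "'a measure \<Rightarrow> ('a \<Rightarrow> ereal) \<Rightarrow> ereal" where
  "ereal_integral M f =
     enn2ereal (\<integral>\<^sup>+x. e2ennreal (f x) \<partial>M) - enn2ereal (\<integral>\<^sup>+x. e2ennreal (- f x) \<partial>M)"

definition equivalent_measures :: "'a measure \<Rightarrow> 'a measure \<Rightarrow> bool" where
  "equivalent_measures M N \<longleftrightarrow>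
     sets M = sets N \<and> absolutely_continuous M N \<and> absolutely_continuous N M"

text \<open>
  The library's \<open>KL_divergence\<close> is real-valued and returns \<open>0\<close> when the log-density is not
  integrable; relative entropy has to be \<open>\<infinity>\<close> there.
\<close>

definition relative_entropy :: "'a measure \<Rightarrow> 'a measure \<Rightarrow> ereal" where
  "relative_entropy Q P =
     (if absolutely_continuous P Q
      then ereal_integral Q (\<lambda>x. ereal (ln (enn2real (RN_deriv P Q x))))
      else \<infinity>)"

definition gaussian :: "real \<Rightarrow> real \<Rightarrow> real measure" where
  "gaussian m v = density lborel (\<lambda>x. ennreal (normal_density m (sqrt v) x))"

definition standard_brownian_motion :: "'a measure \<Rightarrow> (real \<Rightarrow> 'a \<Rightarrow> real) \<Rightarrow> bool" where
  "standard_brownian_motion M B \<longleftrightarrow>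
     prob_space M \<and>
     (\<forall>t\<ge>0. B t \<in> borel_measurable M) \<and>
     (AE \<omega> in M. B 0 \<omega> = 0) \<and>
     (\<forall>\<omega>\<in>space M. continuous_on {0..} (\<lambda>t. B t \<omega>)) \<and>
     (\<forall>s t. 0 \<le> s \<and> s < t \<longrightarrow> distr M borel (\<lambda>\<omega>. B t \<omega> - B s \<omega>) = gaussian 0 (t - s)) \<and>
     (\<forall>n (\<tau> :: nat \<Rightarrow> real). 0 \<le> \<tau> 0 \<and> mono \<tau> \<longrightarrow>
        prob_space.indep_vars M (\<lambda>_. borel) (\<lambda>i \<omega>. B (\<tau> (Suc i)) \<omega> - B (\<tau> i) \<omega>) {..<n})"

text \<open>
  \<open>C([0,T], \<real>)\<close>, its elements being functions that are \<open>undefined\<close> outside \<open>[0,T]\<close>, with the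
  \<open>\<sigma>\<close>-algebra generated by the evaluations (the Borel \<open>\<sigma>\<close>-algebra of the uniform topology).
\<close>

definition path_space :: "real \<Rightarrow> (real \<Rightarrow> real) measure" where
  "path_space T = restrict_space (Pi\<^sub>M {0..T} (\<lambda>_. borel)) {w. continuous_on {0..T} w}"

definition path_law :: "real \<Rightarrow> 'a measure \<Rightarrow> (real \<Rightarrow> 'a \<Rightarrow> real) \<Rightarrow> (real \<Rightarrow> real) measure" where
  "path_law T M Y = distr M (path_space T) (\<lambda>\<omega>. \<lambda>t\<in>{0..T}. Y t \<omega>)"

definition marginal :: "(real \<Rightarrow> real) measure \<Rightarrow> real \<Rightarrow> real measure" where
  "marginal Q t = distr Q borel (\<lambda>w. w t)"

definition finite_mean :: "real measure \<Rightarrow> bool" where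
  "finite_mean \<mu> \<longleftrightarrow> integrable \<mu> (\<lambda>y. y)"

definition mean :: "real measure \<Rightarrow> real" where
  "mean \<mu> = (\<integral>y. y \<partial>\<mu>)"

definition reward_at :: "(real \<Rightarrow> real \<Rightarrow> ereal) \<Rightarrow> real measure \<Rightarrow> real \<Rightarrow> ereal" where
  "reward_at R \<mu> x = R (cdf \<mu> x) (mean \<mu>)"

definition total_reward :: "(real \<Rightarrow> real \<Rightarrow> ereal) \<Rightarrow> real \<Rightarrow> ereal" where
  "total_reward R m = ereal_integral (restrict_space lborel {0..1}) (\<lambda>r. R r m)"

text \<open>Only the values of \<open>R\<close> for first argument in \<open>[0,1]\<close> matter.\<close>

definition reward_function :: "(real \<Rightarrow> real \<Rightarrow> ereal) \<Rightarrow> bool" where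
  "reward_function R \<longleftrightarrow>
     (\<forall>m. mono_on {0..1} (\<lambda>r. R r m)) \<and>
     (\<forall>r\<in>{0..1}. mono (\<lambda>m. R r m)) \<and>
     (\<forall>r\<in>{0<..<1}. \<forall>m. \<bar>R r m\<bar> \<noteq> \<infinity>) \<and>
     (\<forall>m. total_reward R m < \<infinity>)"

definition centralized_welfare ::
  "real \<Rightarrow> real \<Rightarrow> real \<Rightarrow> (real \<Rightarrow> real) measure \<Rightarrow> (real \<Rightarrow> real \<Rightarrow> ereal) \<Rightarrow> ereal" where
  "centralized_welfare T \<sigma> c P R =
     (SUP Q \<in> {Q. prob_space Q \<and> equivalent_measures Q P \<and> finite_mean (marginal Q T)}.
        ereal_integral Q (\<lambda>w. reward_at R (marginal Q T) (w T))
          - ereal (2 * c * \<sigma>\<^sup>2) * relative_entropy Q P)"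

end

theory Submission
  imports Defs
begin

text \<open>
  The reward sees a law \<open>Q\<close> only through the rank and the mean of the terminal value. Any \<open>Q\<close>
  with finite terminal mean that is equivalent to the Brownian law \<open>P\<close> has an atomless terminal law, so the rank is uniformly distributed
  (lemma \<open>distr_cdf_uniform\<close>) and the expected reward is \<open>total_reward R m\<close>, where \<open>m\<close> is the
  terminal mean (lemma \<open>expected_rank_reward\<close>). The planner therefore has to choose \<open>m\<close> and then
  realize it at the least entropy.

  Under \<open>P\<close> the terminal value \<open>f\<close> has law \<open>N(a,v)\<close> with \<open>a = x\<^sub>0\<close> and \<open>v = \<sigma>\<^sup>2 T\<close>. The log-likelihood
  ratio \<open>h\<close> of \<open>N(m,v)\<close> with respect to \<open>N(a,v)\<close> is affine, hence \<open>h(f)\<close> has the same expectation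
  \<open>(m - a)\<^sup>2 / (2v)\<close> under every \<open>Q\<close> giving \<open>f\<close> the mean \<open>m\<close>. As \<open>\<integral>exp (h(f)) dP = 1\<close>, the Gibbs
  inequality \<open>H(Q|P) \<ge> \<integral>h(f) dQ\<close> (lemma \<open>relative_entropy_ge_integral\<close>) bounds the entropy of
  every such \<open>Q\<close> by this number from below, while \<open>dQ = exp (h(f)) dP\<close> attains it (lemma
  \<open>relative_entropy_gaussian_tilt\<close>) and gives \<open>f\<close> the law \<open>N(m,v)\<close>. Multiplied by
  \<open>2c\<sigma>\<^sup>2\<close>, it becomes the cost \<open>c (m - x\<^sub>0)\<^sup>2 / T\<close>. For the identity in place of the terminal value
  the same two lemmas give the statement on measures on the line.
\<close>

section \<open>Integrals of extended-real functions\<close>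

lemma ereal_integral_cong_AE:
  assumes "AE x in M. f x = g x"
  shows "ereal_integral M f = ereal_integral M g"
proof -
  have "(\<integral>\<^sup>+x. e2ennreal (f x) \<partial>M) = (\<integral>\<^sup>+x. e2ennreal (g x) \<partial>M)"
       "(\<integral>\<^sup>+x. e2ennreal (- f x) \<partial>M) = (\<integral>\<^sup>+x. e2ennreal (- g x) \<partial>M)"
    using assms by (auto intro!: nn_integral_cong_AE)
  then show ?thesis
    by (simp add: ereal_integral_def)
qed

lemma ereal_integral_distr:
  assumes [measurable]: "f \<in> measurable M N" "g \<in> borel_measurable N"
  shows "ereal_integral (distr M N f) g = ereal_integral M (\<lambda>x. g (f x))"
  by (simp add: ereal_integral_def nn_integral_distr)

lemma ereal_integral_eq_integral:
  assumes f: "integrable M f"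
  shows "ereal_integral M (\<lambda>x. ereal (f x)) = ereal (\<integral>x. f x \<partial>M)"
proof -
  have fin: "(\<integral>\<^sup>+x. ennreal (f x) \<partial>M) \<noteq> \<infinity>" "(\<integral>\<^sup>+x. ennreal (- f x) \<partial>M) \<noteq> \<infinity>"
    using f by (auto simp: real_integrable_def)
  have "ereal_integral M (\<lambda>x. ereal (f x)) =
      enn2ereal (\<integral>\<^sup>+x. ennreal (f x) \<partial>M) - enn2ereal (\<integral>\<^sup>+x. ennreal (- f x) \<partial>M)"
    by (simp add: ereal_integral_def)
  also have "\<dots> = ereal (\<integral>x. f x \<partial>M)"
    unfolding real_lebesgue_integral_def[OF f] using fin
    by (cases "\<integral>\<^sup>+x. ennreal (f x) \<partial>M"; cases "\<integral>\<^sup>+x. ennreal (- f x) \<partial>M") (auto simp: enn2ereal_ennreal)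
  finally show ?thesis .
qed

section \<open>Rank-based rewards depend on the mean only\<close>

text \<open>
  The probability integral transform. The law \<open>M\<close> is the image of the uniform law under the
  generalized inverse \<open>I\<close> of its distribution function \<open>C\<close>; without atoms \<open>C\<close> is continuous, which
  makes \<open>I\<close> a right inverse of \<open>C\<close>, so \<open>C\<close> carries \<open>M\<close> back to the uniform law.
\<close>

lemma (in cdf_distribution) distr_cdf_uniform:
  assumes atomless: "\<And>x. measure M {x} = 0"
  shows "distr M borel (cdf M) = distr (restrict_space lborel {0<..<1::real}) borel (\<lambda>r. r)"
proof -
  let ?U = "restrict_space lborel {0<..<1::real}"
  have mI: "I \<in> measurable ?U borel"
    using measurable_CI by (simp add: measurable_restrict_space1 cong: measurable_cong_sets sets_restrict_space_cong)
  have inv: "C (I r) = r" if r: "0 < r" "r < 1" for r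
  proof (rule antisym)
    have "(C \<longlongrightarrow> C (I r)) (at_left (I r))"
      using isCont_cdf[of "I r"] atomless
      by (simp add: isCont_def filterlim_at_split)
    moreover have "eventually (\<lambda>x. C x \<le> r) (at_left (I r))"
      unfolding eventually_at_filter
    proof (rule always_eventually, intro allI impI)
      fix x assume "x \<noteq> I r" "x \<in> {..<I r}"
      then show "C x \<le> r"
        using pseudoinverse[OF r, of x] by auto
    qed
    ultimately show "C (I r) \<le> r"
      by (rule tendsto_upperbound) simp
    show "r \<le> C (I r)"
      using pseudoinverse[OF r, of "I r"] by blast
  qed
  have "distr M borel C = distr (distr ?U borel I) borel C"
    by (simp add: distr_I_eq_M)
  also have "\<dots> = distr ?U borel (C \<circ> I)"
    by (rule distr_distr) (use mI in auto)
  also have "\<dots> = distr ?U borel (\<lambda>r. r)"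
    by (rule distr_cong) (auto simp: space_restrict_space inv)
  finally show ?thesis .
qed

text \<open>
  Passing to the open interval removes the two ranks at which the reward may be infinite.
\<close>

lemma total_reward_open_interval:
  "total_reward R m = ereal_integral (restrict_space lborel {0<..<1}) (\<lambda>r. R r m)"
proof -
  have "(\<integral>\<^sup>+r. g r \<partial>restrict_space lborel {0..1}) = (\<integral>\<^sup>+r. g r \<partial>restrict_space lborel {0<..<1})"
    for g :: "real \<Rightarrow> ennreal"
  proof -
    have "AE r in lborel. g r * indicator {0..1::real} r = g r * indicator {0<..<1} r"
      using AE_lborel_singleton[of 0] AE_lborel_singleton[of 1]
      by eventually_elim (auto simp: indicator_def)
    then show ?thesis
      by (simp add: nn_integral_restrict_space nn_integral_cong_AE)
  qed
  then show ?thesis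
    by (simp add: total_reward_def ereal_integral_def)
qed

text \<open>
  The rank has the same, uniform, distribution for every atomless law of \<open>f\<close>, so that the law
  influences the expected reward through its mean alone.
\<close>

lemma expected_rank_reward:
  assumes R: "reward_function R"
    and "prob_space Q" and f[measurable]: "f \<in> borel_measurable Q"
    and atomless: "\<And>x. measure (distr Q borel f) {x} = 0"
  shows "ereal_integral Q (\<lambda>w. reward_at R (distr Q borel f) (f w)) = total_reward R (mean (distr Q borel f))"
proof -
  interpret Q: prob_space Q by fact
  define \<mu> where "\<mu> = distr Q borel f"
  interpret cdf_distribution \<mu>
    by (simp add: cdf_distribution_def \<mu>_def Q.real_distribution_distr)
  let ?U = "restrict_space lborel {0<..<1::real}"
  let ?m = "mean \<mu>"
  \<comment> \<open>On \<open>(0,1)\<close>, where the rank lies almost surely, the reward is a real monotone function; its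
    extension by \<open>0\<close> is Borel, so that the change of variables applies.\<close>
  define \<psi> where "\<psi> r = (if r \<in> {0<..<1} then real_of_ereal (R r ?m) else 0)" for r
  have R_\<psi>: "R r ?m = ereal (\<psi> r)" if "r \<in> {0<..<1}" for r
    using R that by (simp add: reward_function_def \<psi>_def ereal_real')
  have "mono_on {0<..<1} (\<lambda>r. real_of_ereal (R r ?m))"
  proof (rule mono_onI)
    fix r s :: real assume rs: "r \<in> {0<..<1}" "s \<in> {0<..<1}" "r \<le> s"
    then have "R r ?m \<le> R s ?m"
      using R by (auto simp: reward_function_def mono_on_def)
    then show "real_of_ereal (R r ?m) \<le> real_of_ereal (R s ?m)"
      using rs by (simp add: R_\<psi>)
  qed
  then have \<psi>[measurable]: "\<psi> \<in> borel_measurable borel"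
    unfolding \<psi>_def
    by (intro iffD1[OF measurable_restrict_space_iff] borel_measurable_mono_on_fnc) auto
  note unif = distr_cdf_uniform[OF atomless[folded \<mu>_def]]
  have mU: "(\<lambda>r. r) \<in> borel_measurable ?U"
    by (simp add: measurable_restrict_space1)
  have "AE r in distr ?U borel (\<lambda>r. r). r \<in> {0<..<1}"
    using mU by (subst AE_distr_iff) (auto simp: AE_restrict_space_iff)
  then have "AE x in \<mu>. cdf \<mu> x \<in> {0<..<1}"
    unfolding unif[symmetric] by (subst (asm) AE_distr_iff) (auto simp del: greaterThanLessThan_iff)
  then have "AE w in Q. cdf \<mu> (f w) \<in> {0<..<1}"
    unfolding \<mu>_def by (subst (asm) AE_distr_iff) (auto simp del: greaterThanLessThan_iff simp flip: \<mu>_def)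
  then have "ereal_integral Q (\<lambda>w. reward_at R \<mu> (f w)) = ereal_integral Q (\<lambda>w. ereal (\<psi> (cdf \<mu> (f w))))"
    by (intro ereal_integral_cong_AE) (auto simp: reward_at_def R_\<psi>)
  also have "\<dots> = ereal_integral \<mu> (\<lambda>x. ereal (\<psi> (cdf \<mu> x)))"
    unfolding \<mu>_def by (subst ereal_integral_distr) (simp_all flip: \<mu>_def)
  also have "\<dots> = ereal_integral (distr \<mu> borel (cdf \<mu>)) (\<lambda>r. ereal (\<psi> r))"
    by (subst ereal_integral_distr) auto
  also have "\<dots> = ereal_integral ?U (\<lambda>r. ereal (\<psi> r))"
    unfolding unif using mU by (subst ereal_integral_distr) auto
  also have "\<dots> = ereal_integral ?U (\<lambda>r. R r ?m)"
    by (intro ereal_integral_cong_AE) (auto simp: AE_restrict_space_iff R_\<psi>)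
  finally show ?thesis
    by (simp add: total_reward_open_interval \<mu>_def)
qed

section \<open>The Gibbs variational bound for relative entropy\<close>

text \<open>
  One half of the Donsker--Varadhan formula. With \<open>Z = dQ/dP\<close>, the inequality \<open>ln y \<le> y - 1\<close> at
  \<open>y = exp h / Z\<close> bounds \<open>ln Z\<close> from below by \<open>h + 1 - exp h / Z\<close>, and the last term has
  \<open>Q\<close>-integral at most \<open>\<integral>exp h dP \<le> 1\<close>. The same lower bound shows that the negative part of
  \<open>ln Z\<close> is \<open>Q\<close>-integrable, so that the entropy is either \<open>\<infinity>\<close> or an ordinary integral.
\<close>

lemma relative_entropy_ge_integral:
  assumes "prob_space P" "prob_space Q" and sets: "sets Q = sets P"
    and h[measurable]: "h \<in> borel_measurable P"
    and exp_h: "(\<integral>\<^sup>+x. ennreal (exp (h x)) \<partial>P) \<le> 1"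
    and int_h: "integrable Q h"
  shows "ereal (\<integral>x. h x \<partial>Q) \<le> relative_entropy Q P"
proof (cases "absolutely_continuous P Q")
  case False
  then show ?thesis
    by (simp add: relative_entropy_def)
next
  case ac: True
  interpret P: prob_space P by fact
  interpret Q: prob_space Q by fact
  have fin_Q: "finite_measure Q" by unfold_locales
  obtain Z where Z[measurable]: "Z \<in> borel_measurable P"
    and RN: "AE x in P. RN_deriv P Q x = ennreal (Z x)"
    and Z_pos: "AE x in Q. 0 < Z x" and Z_nonneg: "\<And>x. 0 \<le> Z x"
    using P.real_RN_deriv[OF fin_Q ac sets] by blast
  have Q_eq: "Q = density P (\<lambda>x. ennreal (Z x))"
    using P.density_RN_deriv[OF ac sets] RN density_cong[of "RN_deriv P Q" P "\<lambda>x. ennreal (Z x)"]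
    by simp
  have [measurable_cong]: "sets Q = sets P" by (rule sets)
  define L where "L x = ln (Z x)" for x
  define k where "k x = exp (h x) / Z x" for x
  have [measurable]: "L \<in> borel_measurable Q" "k \<in> borel_measurable Q"
    by (auto simp: L_def[abs_def] k_def[abs_def])
  have k_nonneg: "0 \<le> k x" for x
    by (simp add: k_def Z_nonneg)
  have "(\<integral>\<^sup>+x. ennreal (k x) \<partial>Q) = (\<integral>\<^sup>+x. ennreal (Z x) * ennreal (k x) \<partial>P)"
    unfolding Q_eq by (rule nn_integral_density) (auto simp: k_def[abs_def])
  also have "\<dots> \<le> (\<integral>\<^sup>+x. ennreal (exp (h x)) \<partial>P)"
    by (intro nn_integral_mono) (auto simp: k_def Z_nonneg ennreal_mult[symmetric])
  finally have k_le: "(\<integral>\<^sup>+x. ennreal (k x) \<partial>Q) \<le> 1"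
    using exp_h by simp
  then have int_k: "integrable Q k"
    by (intro integrableI_bounded) (auto simp: k_nonneg intro: le_less_trans)
  have "ennreal (\<integral>x. k x \<partial>Q) \<le> 1"
    using k_le by (simp add: nn_integral_eq_integral int_k k_nonneg)
  then have k_le': "(\<integral>x. k x \<partial>Q) \<le> 1"
    by simp
  have L_ge: "AE x in Q. h x + 1 - k x \<le> L x"
    using Z_pos
  proof eventually_elim
    case (elim x)
    then have "h x - L x = ln (k x)"
      by (simp add: k_def L_def ln_div)
    also have "\<dots> \<le> k x - 1"
      using elim by (intro ln_le_minus_one) (simp add: k_def)
    finally show ?case by simp
  qed
  have "AE x in Q. RN_deriv P Q x = ennreal (Z x)"
    by (rule absolutely_continuous_AE[OF sets ac RN])
  then have ent: "relative_entropy Q P = ereal_integral Q (\<lambda>x. ereal (L x))"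
    using ac by (auto simp: relative_entropy_def L_def Z_nonneg intro!: ereal_integral_cong_AE)
  show ?thesis
  proof (cases "(\<integral>\<^sup>+x. ennreal (L x) \<partial>Q) = \<infinity>")
    case True
    then show ?thesis
      by (simp add: ent ereal_integral_def)
  next
    case False
    have int_bound: "integrable Q (\<lambda>x. h x + 1 - k x)"
      using int_h int_k by auto
    have "(\<integral>\<^sup>+x. ennreal (- L x) \<partial>Q) \<le> (\<integral>\<^sup>+x. ennreal (norm (h x + 1 - k x)) \<partial>Q)"
      using L_ge by (intro nn_integral_mono_AE) (auto elim!: eventually_mono intro!: ennreal_leI)
    also have "\<dots> < \<infinity>"
      using int_bound by (simp add: integrable_iff_bounded)
    finally have int_L: "integrable Q L"
      using False by (auto simp: real_integrable_def)
    have "(\<integral>x. h x \<partial>Q) \<le> (\<integral>x. h x + 1 - k x \<partial>Q)"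
      using int_h int_k k_le' by (simp add: Q.prob_space)
    also have "\<dots> \<le> (\<integral>x. L x \<partial>Q)"
      using int_h int_k int_L L_ge by (intro integral_mono_AE) auto
    finally show ?thesis
      by (simp add: ent ereal_integral_eq_integral int_L)
  qed
qed

text \<open>
  The equality case of the preceding bound: \<open>h\<close> is then the log-density itself.
\<close>

lemma relative_entropy_density_exp:
  assumes "prob_space P" "prob_space Q"
    and h[measurable]: "h \<in> borel_measurable P"
    and Q: "Q = density P (\<lambda>x. ennreal (exp (h x)))"
    and int_h: "integrable Q h"
  shows "relative_entropy Q P = ereal (\<integral>x. h x \<partial>Q)"
proof -
  interpret P: prob_space P by fact
  interpret Q: prob_space Q by fact
  have ac: "absolutely_continuous P Q"
    unfolding Q by (rule absolutely_continuousI_density) simp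
  have "sigma_finite_measure Q"
    by unfold_locales
  then have "AE x in P. ennreal (exp (h x)) = RN_deriv P Q x"
    by (intro RN_deriv_unique_sigma_finite) (simp_all add: Q)
  then have "AE x in Q. ennreal (exp (h x)) = RN_deriv P Q x"
    by (intro absolutely_continuous_AE[OF _ ac]) (simp add: Q)
  then have "AE x in Q. ereal (ln (enn2real (RN_deriv P Q x))) = ereal (h x)"
    by eventually_elim (metis enn2real_ennreal exp_ge_zero ln_exp)
  then have "relative_entropy Q P = ereal_integral Q (\<lambda>x. ereal (h x))"
    using ac by (simp add: relative_entropy_def ereal_integral_cong_AE)
  then show ?thesis
    by (simp add: ereal_integral_eq_integral int_h)
qed

lemma equivalent_measures_density:
  assumes [measurable]: "g \<in> borel_measurable M" and pos: "\<And>x. 0 < g x"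
  shows "equivalent_measures (density M g) M"
proof -
  have "g x \<noteq> 0" for x
    using pos[of x] by simp
  then have "null_sets (density M g) = null_sets M"
    by (intro set_eqI) (simp add: null_sets_density_iff, metis AE_iff_null_sets null_setsD2)
  then show ?thesis
    by (simp add: equivalent_measures_def absolutely_continuous_def)
qed

section \<open>Gaussian observables and their exponential tilts\<close>

lemma
  assumes v: "v > 0"
  shows prob_space_gaussian: "prob_space (gaussian m v)"
    and finite_mean_gaussian: "finite_mean (gaussian m v)"
    and mean_gaussian: "mean (gaussian m v) = m"
    and equivalent_gaussian_lborel: "equivalent_measures (gaussian m v) lborel"
proof -
  have s: "0 < sqrt v" using v by simp
  show "prob_space (gaussian m v)"
    unfolding gaussian_def using s by (rule prob_space_normal_density)
  show "finite_mean (gaussian m v)"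
    unfolding finite_mean_def gaussian_def
    using integrable_normal_moment_nz_1[OF s, of m] by (simp add: integrable_density)
  show "mean (gaussian m v) = m"
    unfolding mean_def gaussian_def
    using normal_moment_nz_1[OF s, of m]
    by (simp add: integral_density has_bochner_integral_integral_eq)
  show "equivalent_measures (gaussian m v) lborel"
    unfolding gaussian_def using normal_density_pos[OF s]
    by (intro equivalent_measures_density) auto
qed

text \<open>
  The log-likelihood ratio of \<open>N(m,v)\<close> with respect to \<open>N(a,v)\<close>. It is affine in \<open>x\<close> because the
  variances agree, so its integral against any law is determined by the mean of that law.
\<close>

definition gaussian_llr :: "real \<Rightarrow> real \<Rightarrow> real \<Rightarrow> real \<Rightarrow> real" where
  "gaussian_llr v a m x = (m - a) * (2 * x - a - m) / (2 * v)"

lemma measurable_gaussian_llr[measurable]: "gaussian_llr v a m \<in> borel_measurable borel"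
  unfolding gaussian_llr_def[abs_def] by measurable

lemma density_gaussian_llr:
  assumes v: "v > 0"
  shows "density (gaussian a v) (\<lambda>x. ennreal (exp (gaussian_llr v a m x))) = gaussian m v"
proof -
  have "normal_density a (sqrt v) x * exp (gaussian_llr v a m x) = normal_density m (sqrt v) x" for x
  proof -
    have "- (x - a)\<^sup>2 / (2 * v) + gaussian_llr v a m x = - (x - m)\<^sup>2 / (2 * v)"
      using v by (simp add: gaussian_llr_def field_simps power2_eq_square)
    then have "exp (- (x - a)\<^sup>2 / (2 * v)) * exp (gaussian_llr v a m x) = exp (- (x - m)\<^sup>2 / (2 * v))"
      by (simp flip: exp_add)
    then show ?thesis
      using v by (simp add: normal_density_def)
  qed
  then show ?thesis
    by (simp add: gaussian_def density_density_eq ennreal_mult[symmetric])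
qed

text \<open>
  Tilting acts on the law of \<open>f\<close> only and leaves the conditional laws given \<open>f\<close> unchanged: this is
  the entropically cheapest way to move the mean of \<open>f\<close>. For Brownian paths with \<open>f\<close> the terminal
  value, the tilted law is that of Brownian motion with a constant drift.
\<close>

lemma gaussian_tilt:
  fixes m :: real
  assumes "prob_space P" and f[measurable]: "f \<in> borel_measurable P"
    and law: "distr P borel f = gaussian a v" and v: "v > 0"
  defines "Q \<equiv> density P (\<lambda>w. ennreal (exp (gaussian_llr v a m (f w))))"
  shows distr_gaussian_tilt: "distr Q borel f = gaussian m v"
    and prob_space_gaussian_tilt: "prob_space Q"
    and equivalent_gaussian_tilt: "equivalent_measures Q P"
proof -
  show law_Q: "distr Q borel f = gaussian m v"
    unfolding Q_def density_gaussian_llr[OF v, of a m, symmetric] law[symmetric]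
    by (rule density_distr[symmetric]) simp_all
  have "prob_space (distr Q borel f)"
    by (simp only: law_Q prob_space_gaussian[OF v])
  then show "prob_space Q"
    by (rule prob_space_distrD[rotated]) (simp add: Q_def)
  show "equivalent_measures Q P"
    unfolding Q_def by (rule equivalent_measures_density) auto
qed

lemma integral_gaussian_llr:
  assumes "prob_space Q" and f: "integrable Q f" and mean: "(\<integral>w. f w \<partial>Q) = m"
  shows "integrable Q (\<lambda>w. gaussian_llr v a m (f w))"
    and "(\<integral>w. gaussian_llr v a m (f w) \<partial>Q) = (m - a)\<^sup>2 / (2 * v)"
proof -
  interpret prob_space Q by fact
  show "integrable Q (\<lambda>w. gaussian_llr v a m (f w))"
    unfolding gaussian_llr_def using f by auto
  show "(\<integral>w. gaussian_llr v a m (f w) \<partial>Q) = (m - a)\<^sup>2 / (2 * v)"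
    unfolding gaussian_llr_def using f by (simp add: prob_space mean power2_eq_square)
qed

text \<open>
  The cost of moving the mean of a Gaussian observable. The same bound serves for the terminal value
  on path space and, with \<open>f\<close> the identity, for measures on the line.
\<close>

lemma relative_entropy_ge_gaussian:
  assumes P: "prob_space P" and f: "f \<in> borel_measurable P"
    and law: "distr P borel f = gaussian a v" and v: "v > 0"
    and Q: "prob_space Q" "sets Q = sets P" "integrable Q f" "(\<integral>w. f w \<partial>Q) = m"
  shows "ereal ((m - a)\<^sup>2 / (2 * v)) \<le> relative_entropy Q P"
proof -
  note [measurable] = f
  interpret tilt: prob_space "density P (\<lambda>w. ennreal (exp (gaussian_llr v a m (f w))))"
    by (rule prob_space_gaussian_tilt[OF P f law v])
  have "(\<integral>\<^sup>+w. ennreal (exp (gaussian_llr v a m (f w))) \<partial>P) = 1"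
    using tilt.emeasure_space_1 by (simp add: emeasure_density cong: nn_integral_cong_simp)
  then have "ereal (\<integral>w. gaussian_llr v a m (f w) \<partial>Q) \<le> relative_entropy Q P"
    using Q by (intro relative_entropy_ge_integral P integral_gaussian_llr) auto
  then show ?thesis
    using integral_gaussian_llr(2)[OF Q(1,3,4)] by simp
qed

lemma relative_entropy_gaussian_tilt:
  assumes P: "prob_space P" and f: "f \<in> borel_measurable P"
    and law: "distr P borel f = gaussian a v" and v: "v > 0"
  shows "relative_entropy (density P (\<lambda>w. ennreal (exp (gaussian_llr v a m (f w))))) P
    = ereal ((m - a)\<^sup>2 / (2 * v))" (is "relative_entropy ?Q P = _")
proof -
  note [measurable] = f
  have law_Q: "distr ?Q borel f = gaussian m v"
    by (rule distr_gaussian_tilt[OF P f law v])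
  have Q: "prob_space ?Q"
    by (rule prob_space_gaussian_tilt[OF P f law v])
  have int: "integrable ?Q f"
    using finite_mean_gaussian[OF v, of m] unfolding finite_mean_def law_Q[symmetric]
    by (simp add: integrable_distr_eq)
  have mean: "(\<integral>w. f w \<partial>?Q) = m"
    using mean_gaussian[OF v, of m] unfolding mean_def law_Q[symmetric]
    by (simp add: integral_distr)
  note llr = integral_gaussian_llr[OF Q int mean, of v a]
  show ?thesis
    using relative_entropy_density_exp[OF P Q _ refl llr(1)] llr(2) by simp
qed

section \<open>The Brownian path law\<close>

lemma atomless_distr_of_gaussian:
  assumes f[measurable]: "f \<in> borel_measurable P"
    and law: "distr P borel f = gaussian a v" and v: "v > 0"
    and Q: "equivalent_measures Q P"
  shows "measure (distr Q borel f) {x} = 0"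
proof -
  have sets[measurable_cong]: "sets Q = sets P"
    using Q by (simp add: equivalent_measures_def)
  have "{x} \<in> null_sets lborel"
    by (simp add: null_sets_def)
  then have "{x} \<in> null_sets (gaussian a v)"
    using equivalent_gaussian_lborel[OF v]
    by (auto simp: equivalent_measures_def absolutely_continuous_def)
  then have "f -` {x} \<inter> space P \<in> null_sets P"
    by (simp add: law[symmetric] null_sets_distr_iff)
  then have "f -` {x} \<inter> space Q \<in> null_sets Q"
    using Q sets_eq_imp_space_eq[OF sets]
    by (auto simp: equivalent_measures_def absolutely_continuous_def)
  then have "emeasure (distr Q borel f) {x} = 0"
    by (auto simp: emeasure_distr dest: null_setsD1)
  then show ?thesis
    by (simp add: measure_def)
qed

lemma distr_affine_gaussian:
  assumes "v > 0" "s > 0"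
  shows "distr (gaussian 0 v) borel (\<lambda>x. a + s * x) = gaussian a (s\<^sup>2 * v)"
proof -
  interpret prob_space "gaussian 0 v"
    by (rule prob_space_gaussian) fact
  have "distributed (gaussian 0 v) lborel (\<lambda>x. x) (normal_density 0 (sqrt v))"
    by (auto simp: distributed_def gaussian_def distr_id2)
  then have "distributed (gaussian 0 v) lborel (\<lambda>x. a + s * x) (normal_density (a + s * 0) (\<bar>s\<bar> * sqrt v))"
    using assms by (intro normal_density_affine) auto
  then have "distr (gaussian 0 v) lborel (\<lambda>x. a + s * x) = density lborel (normal_density a (s * sqrt v))"
    using assms by (simp add: distributed_def)
  moreover have "sqrt (s\<^sup>2 * v) = s * sqrt v"
    using assms by (simp add: real_sqrt_mult)
  moreover have "distr (gaussian 0 v) lborel (\<lambda>x. a + s * x) = distr (gaussian 0 v) borel (\<lambda>x. a + s * x)"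
    by (rule distr_cong) auto
  ultimately show ?thesis
    by (simp add: gaussian_def)
qed

lemma measurable_path_space_eval:
  assumes "t \<in> {0..T}"
  shows "(\<lambda>w. w t) \<in> borel_measurable (path_space T)"
  unfolding path_space_def
  by (intro measurable_restrict_space1 measurable_component_singleton assms)

lemma
  fixes T \<sigma> x\<^sub>0 :: real
  assumes T: "T > 0" and \<sigma>: "\<sigma> > 0" and B: "standard_brownian_motion M B"
  defines "P \<equiv> path_law T M (\<lambda>t \<omega>. x\<^sub>0 + \<sigma> * B t \<omega>)"
  shows prob_space_brownian_path_law: "prob_space P"
    and brownian_path_law_eval: "distr P borel (\<lambda>w. w T) = gaussian x\<^sub>0 (\<sigma>\<^sup>2 * T)"
proof -
  interpret prob_space M
    using B by (simp add: standard_brownian_motion_def)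
  have Bm[measurable]: "B t \<in> borel_measurable M" if "t \<ge> 0" for t
    using B that by (simp add: standard_brownian_motion_def)
  have cont: "continuous_on {0..} (\<lambda>t. B t \<omega>)" if "\<omega> \<in> space M" for \<omega>
    using B that by (simp add: standard_brownian_motion_def)
  let ?Y = "\<lambda>\<omega>. \<lambda>t\<in>{0..T}. x\<^sub>0 + \<sigma> * B t \<omega>"
  have "continuous_on {0..T} (?Y \<omega>)" if "\<omega> \<in> space M" for \<omega>
  proof -
    have "continuous_on {0..T} (\<lambda>t. x\<^sub>0 + \<sigma> * B t \<omega>)"
      by (intro continuous_intros continuous_on_subset[OF cont[OF that]]) auto
    then show ?thesis
      by (simp cong: continuous_on_cong_simp)
  qed
  then have Y: "?Y \<in> measurable M (path_space T)"
    unfolding path_space_def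
    by (intro measurable_restrict_space2 measurable_restrict) auto
  show "prob_space P"
    unfolding P_def path_law_def by (rule prob_space_distr[OF Y])
  have "distr P borel (\<lambda>w. w T) = distr M borel ((\<lambda>w. w T) \<circ> ?Y)"
    unfolding P_def path_law_def
    by (rule distr_distr[OF measurable_path_space_eval Y]) (use T in auto)
  also have "\<dots> = distr M borel (\<lambda>\<omega>. x\<^sub>0 + \<sigma> * (B T \<omega> - B 0 \<omega>))"
  proof (rule distr_cong_AE)
    show "AE \<omega> in M. ((\<lambda>w. w T) \<circ> ?Y) \<omega> = x\<^sub>0 + \<sigma> * (B T \<omega> - B 0 \<omega>)"
      using B T by (auto simp: standard_brownian_motion_def elim!: eventually_mono)
  qed (use T in \<open>auto simp: comp_def\<close>)
  also have "\<dots> = distr (distr M borel (\<lambda>\<omega>. B T \<omega> - B 0 \<omega>)) borel (\<lambda>x. x\<^sub>0 + \<sigma> * x)"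
    using T by (subst distr_distr) (auto simp: comp_def)
  also have "distr M borel (\<lambda>\<omega>. B T \<omega> - B 0 \<omega>) = gaussian 0 (T - 0)"
    using B T unfolding standard_brownian_motion_def by blast
  finally show "distr P borel (\<lambda>w. w T) = gaussian x\<^sub>0 (\<sigma>\<^sup>2 * T)"
    using distr_affine_gaussian[OF T \<sigma>] by simp
qed

section \<open>Optimal welfare and minimal entropy\<close>

text \<open>
  Every competitor \<open>Q\<close> with terminal mean \<open>m\<close> collects the reward of the tilt with mean \<open>m\<close> and pays
  at least its entropy, so the two suprema are compared term by term. The argument takes place on the
  law of the terminal value, which is why \<open>P\<close> enters only through its marginal at time \<open>T\<close>.
\<close>

lemma centralized_welfare_eq:
  assumes T: "T > 0" and \<sigma>: "\<sigma> > 0" and c: "c > 0"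
    and P: "prob_space P" and sets_P: "sets P = sets (path_space T)"
    and law: "distr P borel (\<lambda>w. w T) = gaussian x\<^sub>0 (\<sigma>\<^sup>2 * T)"
    and R: "reward_function R"
  shows "centralized_welfare T \<sigma> c P R = (SUP m. total_reward R m - ereal (c / T * (m - x\<^sub>0)\<^sup>2))"
proof -
  have v: "\<sigma>\<^sup>2 * T > 0"
    using T \<sigma> by simp
  have cost: "ereal (2 * c * \<sigma>\<^sup>2) * ereal ((m - x\<^sub>0)\<^sup>2 / (2 * (\<sigma>\<^sup>2 * T))) = ereal (c / T * (m - x\<^sub>0)\<^sup>2)" for m
    using \<sigma> by simp
  have eval: "(\<lambda>w. w T) \<in> borel_measurable Q" if "sets Q = sets P" for Q
    using measurable_path_space_eval[of T T] T
    by (subst measurable_cong_sets[OF that[unfolded sets_P] refl]) simp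
  have reward: "ereal_integral Q (\<lambda>w. reward_at R (marginal Q T) (w T)) = total_reward R (mean (marginal Q T))"
    if "prob_space Q" "equivalent_measures Q P" for Q
    unfolding marginal_def using that
    by (intro expected_rank_reward R eval atomless_distr_of_gaussian[OF eval[OF refl] law v])
      (auto simp: equivalent_measures_def)
  let ?W = "\<lambda>Q. ereal_integral Q (\<lambda>w. reward_at R (marginal Q T) (w T))
    - ereal (2 * c * \<sigma>\<^sup>2) * relative_entropy Q P"
  let ?\<Q> = "{Q. prob_space Q \<and> equivalent_measures Q P \<and> finite_mean (marginal Q T)}"
  show ?thesis
    unfolding centralized_welfare_def
  proof (rule antisym)
    show "(SUP Q\<in>?\<Q>. ?W Q) \<le> (SUP m. total_reward R m - ereal (c / T * (m - x\<^sub>0)\<^sup>2))"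
    proof (rule SUP_least)
      fix Q assume "Q \<in> ?\<Q>"
      then have Q: "prob_space Q" "equivalent_measures Q P" "finite_mean (marginal Q T)"
        by auto
      define m where "m = mean (marginal Q T)"
      have sets_Q: "sets Q = sets P"
        using Q(2) by (simp add: equivalent_measures_def)
      have "integrable Q (\<lambda>w. w T)" "(\<integral>w. w T \<partial>Q) = m"
        using Q(3) eval[OF sets_Q]
        by (auto simp: finite_mean_def marginal_def m_def mean_def integrable_distr_eq integral_distr)
      then have "ereal ((m - x\<^sub>0)\<^sup>2 / (2 * (\<sigma>\<^sup>2 * T))) \<le> relative_entropy Q P"
        by (rule relative_entropy_ge_gaussian[OF P eval[OF refl] law v Q(1) sets_Q])
      then have "ereal (c / T * (m - x\<^sub>0)\<^sup>2) \<le> ereal (2 * c * \<sigma>\<^sup>2) * relative_entropy Q P"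
        unfolding cost[symmetric] using c by (intro ereal_mult_left_mono) auto
      then have "?W Q \<le> total_reward R m - ereal (c / T * (m - x\<^sub>0)\<^sup>2)"
        unfolding reward[OF Q(1,2)] m_def by (intro ereal_minus_mono) auto
      then show "?W Q \<le> (SUP m. total_reward R m - ereal (c / T * (m - x\<^sub>0)\<^sup>2))"
        by (rule SUP_upper2[OF UNIV_I])
    qed
    show "(SUP m. total_reward R m - ereal (c / T * (m - x\<^sub>0)\<^sup>2)) \<le> (SUP Q\<in>?\<Q>. ?W Q)"
    proof (rule SUP_least)
      fix m :: real
      define Q where "Q = density P (\<lambda>w. ennreal (exp (gaussian_llr (\<sigma>\<^sup>2 * T) x\<^sub>0 m (w T))))"
      note tilt = gaussian_tilt[OF P eval[OF refl] law v, of m, folded Q_def]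
      have marg: "marginal Q T = gaussian m (\<sigma>\<^sup>2 * T)"
        unfolding marginal_def by (rule tilt(1))
      have "relative_entropy Q P = ereal ((m - x\<^sub>0)\<^sup>2 / (2 * (\<sigma>\<^sup>2 * T)))"
        unfolding Q_def by (rule relative_entropy_gaussian_tilt[OF P eval[OF refl] law v])
      then have "?W Q = total_reward R m - ereal (c / T * (m - x\<^sub>0)\<^sup>2)"
        using cost[of m] by (simp only: reward[OF tilt(2,3), unfolded marg] marg mean_gaussian[OF v])
      moreover have "Q \<in> ?\<Q>"
        using tilt(2,3) by (simp add: marg finite_mean_gaussian[OF v])
      ultimately show "total_reward R m - ereal (c / T * (m - x\<^sub>0)\<^sup>2) \<le> (SUP Q\<in>?\<Q>. ?W Q)"
        by (metis (no_types, lifting) SUP_upper)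
    qed
  qed
qed

lemma relative_entropy_gaussian_minimal:
  assumes v: "v > 0"
  shows relative_entropy_gaussian: "relative_entropy (gaussian m v) (gaussian a v) = ereal ((m - a)\<^sup>2 / (2 * v))"
    and is_arg_min_gaussian: "is_arg_min (\<lambda>\<mu>. relative_entropy \<mu> (gaussian a v))
      (\<lambda>\<mu>. prob_space \<mu> \<and> equivalent_measures \<mu> lborel \<and> finite_mean \<mu> \<and> mean \<mu> = m) (gaussian m v)"
proof -
  have id: "(\<lambda>x. x) \<in> borel_measurable (gaussian a v)"
    by (simp add: gaussian_def)
  have law: "distr (gaussian a v) borel (\<lambda>x. x) = gaussian a v"
    by (simp add: gaussian_def distr_id2)
  note P = prob_space_gaussian[OF v, of a]
  show eq: "relative_entropy (gaussian m v) (gaussian a v) = ereal ((m - a)\<^sup>2 / (2 * v))"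
    using relative_entropy_gaussian_tilt[OF P id law v, of m] by (simp only: density_gaussian_llr[OF v])
  have "\<not> relative_entropy \<mu> (gaussian a v) < relative_entropy (gaussian m v) (gaussian a v)"
    if "prob_space \<mu>" "equivalent_measures \<mu> lborel" "finite_mean \<mu>" "mean \<mu> = m" for \<mu>
  proof -
    have "sets \<mu> = sets (gaussian a v)"
      using that(2) by (simp add: equivalent_measures_def gaussian_def)
    then show ?thesis
      using relative_entropy_ge_gaussian[OF P id law v that(1) _ that(3)[unfolded finite_mean_def] that(4)[unfolded mean_def]]
      by (simp add: eq not_less)
  qed
  then show "is_arg_min (\<lambda>\<mu>. relative_entropy \<mu> (gaussian a v))
      (\<lambda>\<mu>. prob_space \<mu> \<and> equivalent_measures \<mu> lborel \<and> finite_mean \<mu> \<and> mean \<mu> = m) (gaussian m v)"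
    using prob_space_gaussian[OF v] equivalent_gaussian_lborel[OF v] finite_mean_gaussian[OF v] mean_gaussian[OF v]
    by (auto simp: is_arg_min_def)
qed

theorem mainTheorem8:
  fixes T \<sigma> c x\<^sub>0 :: real
    and M :: "'a measure" and B :: "real \<Rightarrow> 'a \<Rightarrow> real"
    and R :: "real \<Rightarrow> real \<Rightarrow> ereal"
  assumes "T > 0" and "\<sigma> > 0" and "c > 0"
    and "standard_brownian_motion M B"
    and "reward_function R"
  shows "centralized_welfare T \<sigma> c (path_law T M (\<lambda>t \<omega>. x\<^sub>0 + \<sigma> * B t \<omega>)) R
           = (SUP m. total_reward R m - ereal (c / T * (m - x\<^sub>0)\<^sup>2))
         \<and> (\<forall>m. is_arg_min (\<lambda>\<mu>. relative_entropy \<mu> (gaussian x\<^sub>0 (\<sigma>\<^sup>2 * T)))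
                  (\<lambda>\<mu>. prob_space \<mu> \<and> equivalent_measures \<mu> lborel \<and> finite_mean \<mu> \<and> mean \<mu> = m)
                  (gaussian m (\<sigma>\<^sup>2 * T))
              \<and> relative_entropy (gaussian m (\<sigma>\<^sup>2 * T)) (gaussian x\<^sub>0 (\<sigma>\<^sup>2 * T))
                  = ereal ((m - x\<^sub>0)\<^sup>2 / (2 * \<sigma>\<^sup>2 * T)))"
proof (intro conjI allI)
  have v: "\<sigma>\<^sup>2 * T > 0"
    using assms by simp
  show "centralized_welfare T \<sigma> c (path_law T M (\<lambda>t \<omega>. x\<^sub>0 + \<sigma> * B t \<omega>)) R
      = (SUP m. total_reward R m - ereal (c / T * (m - x\<^sub>0)\<^sup>2))"
    using assms
    by (intro centralized_welfare_eq prob_space_brownian_path_law brownian_path_law_eval)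
      (simp_all add: path_law_def)
  fix m
  show "is_arg_min (\<lambda>\<mu>. relative_entropy \<mu> (gaussian x\<^sub>0 (\<sigma>\<^sup>2 * T)))
      (\<lambda>\<mu>. prob_space \<mu> \<and> equivalent_measures \<mu> lborel \<and> finite_mean \<mu> \<and> mean \<mu> = m)
      (gaussian m (\<sigma>\<^sup>2 * T))"
    by (rule is_arg_min_gaussian[OF v])
  show "relative_entropy (gaussian m (\<sigma>\<^sup>2 * T)) (gaussian x\<^sub>0 (\<sigma>\<^sup>2 * T))
      = ereal ((m - x\<^sub>0)\<^sup>2 / (2 * \<sigma>\<^sup>2 * T))"
    by (simp only: relative_entropy_gaussian[OF v] mult.assoc)
qed

end
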